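(* Let $V_0,V_1,V_2\in M_N(\mathbb{C})$ be such that $V_{-1}V_0=0$, $V_{-1}V_1=0$ and $T_2(V_2)=V_1V_0$, and let $(V_k)_{k\ge 3}$ be defined by the recursion $V_k=\sum_{j=1}^{k-1} j\,T_k^{-1}(V_jV_{k-1-j})$. If $\|V_0\|_F\le \frac14$, $\|V_1\|_F\le\frac18$ and $\|V_2\|_F\le \frac1{16}$, then $$\|V_k\|_F\le \frac{1}{2^{k+2}}\qquad\text{for every } k\ge 3.$$
   Context: Fix integers $N\ge 1$ and $0\le m\le N$ and put $V_{-1}=\begin{pmatrix}-2I_m&0\\0&0\end{pmatrix}\in M_N(\mathbb{C})$. For $k\ge 2$ let $T_k:M_N(\mathbb{C})\to M_N(\mathbb{C})$ be the linear operator $T_k(a)=k(k-1)a+V_{-1}a-k\,aV_{-1}$; it is invertible for $k\ge 3$. $\|\cdot\|_F$ is the Frobenius norm. (The conditions on $V_0,V_1,V_2$ and the recursion are exactly the conditions for the formal Laurent series $V(x)=\sum_{k\ge -1}V_kx^k$ to satisfy $V''(x)=V'(x)V(x)$.) *)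

theory Defs
  imports "HOL-Analysis.Analysis"
begin

type_synonym 'n sqmat = "complex ^ 'n ^ 'n"

text \<open>
  \<open>M\<^sub>N(\<complex>)\<close> is \<open>'n sqmat\<close> with \<open>N = CARD('n)\<close>. The linear order on \<open>'n\<close> is
  there only to say which indices are the first \<open>m\<close> ones: \<open>i\<close> has position
  \<open>card {l. l < i}\<close>, counted from \<open>0\<close>.
\<close>

definition V_neg1 :: "nat \<Rightarrow> ('n::{finite,linorder}) sqmat" where
  "V_neg1 m = (\<chi> i j. if i = j \<and> card {l. l < i} < m then -2 else 0)"

definition T_op ::
  "nat \<Rightarrow> nat \<Rightarrow> ('n::{finite,linorder}) sqmat \<Rightarrow> 'n sqmat" where
  "T_op m k a = (real k * (real k - 1)) *\<^sub>R a + V_neg1 m ** a - real k *\<^sub>R (a ** V_neg1 m)"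

definition frobenius_norm :: "complex ^ 'n ^ 'm \<Rightarrow> real" where
  "frobenius_norm A = sqrt (\<Sum>i\<in>UNIV. \<Sum>j\<in>UNIV. (cmod (A $ i $ j))\<^sup>2)"

lemma frobenius_norm_eq_norm: "frobenius_norm A = norm A"
  by (simp add: frobenius_norm_def norm_vec_def L2_set_def sum_nonneg)

lemma T_op_nth:
  fixes a :: "('n::{finite,linorder}) sqmat" and m k :: nat
  defines "v \<equiv> \<lambda>i::'n. if card {l. l < i} < m then -2 else 0 :: complex"
  shows "T_op m k a $ i $ j =
    (of_nat k * (of_nat k - 1) + v i - of_nat k * v j) * a $ i $ j"
proof -
  have V: "V_neg1 m $ p $ q = (if p = q then v p else 0)" for p q :: 'n
    by (simp add: V_neg1_def v_def)
  have "(V_neg1 m ** a) $ i $ j = v i * a $ i $ j"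
    by (simp add: matrix_matrix_mult_def V if_distrib[of "\<lambda>x. x * _"] cong: if_cong)
  moreover have "(a ** V_neg1 m) $ i $ j = a $ i $ j * v j"
    by (simp add: matrix_matrix_mult_def V if_distrib[of "\<lambda>x. _ * x"] cong: if_cong)
  moreover have "T_op m k a $ i $ j = (real k * (real k - 1)) *\<^sub>R (a $ i $ j)
      + (V_neg1 m ** a) $ i $ j - real k *\<^sub>R ((a ** V_neg1 m) $ i $ j)"
    by (simp add: T_op_def)
  ultimately show ?thesis
    by (simp add: scaleR_conv_of_real[where 'a = complex] algebra_simps)
qed

text \<open>Hence \<open>inv (T_op m k)\<close> is the two-sided inverse of \<open>T_op m k\<close> when \<open>k \<ge> 3\<close>.\<close>

lemma bij_T_op:
  assumes "k \<ge> 3"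
  shows "bij (T_op m k :: ('n::{finite,linorder}) sqmat \<Rightarrow> 'n sqmat)"
proof -
  define v where "v = (\<lambda>i::'n. if card {l. l < i} < m then -2 else 0 :: complex)"
  define d where "d = (\<lambda>i j. of_nat k * (of_nat k - 1) + v i - of_nat k * v j)"
  have T: "T_op m k a $ i $ j = d i j * a $ i $ j" for a :: "'n sqmat" and i j
    by (simp add: T_op_nth d_def v_def)
  have d: "d i j \<noteq> 0" for i j
  proof -
    define w where "w = (\<lambda>i::'n. if card {l. l < i} < m then -2 else 0 :: real)"
    have "d i j = of_real (real k * (real k - 1) + w i - real k * w j)"
      by (simp add: d_def v_def w_def)
    moreover have "real k * (real k - 1) \<ge> 3 * 2"
      using assms by (intro mult_mono) auto
    then have "real k * (real k - 1) + w i - real k * w j > 0"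
      by (simp add: w_def)
    ultimately show ?thesis
      by (metis of_real_eq_0_iff less_irrefl)
  qed
  show ?thesis
  proof (rule o_bij[where g = "\<lambda>b. \<chi> i j. b $ i $ j / d i j"])
    show "(\<lambda>b. \<chi> i j. b $ i $ j / d i j) \<circ> T_op m k = id"
      by (rule ext) (simp add: vec_eq_iff T d)
    show "T_op m k \<circ> (\<lambda>b. \<chi> i j. b $ i $ j / d i j) = id"
      by (rule ext) (simp add: vec_eq_iff T d)
  qed
qed

end

theory Submission
  imports Defs
begin

text \<open>
  The bound is proved by strong induction on \<open>k\<close>, and two estimates carry it.

  The operator \<open>T_op m k\<close> is diagonal in the basis of matrix units, with eigenvalues
  among \<open>k (k - 1)\<close>, \<open>(k - 2) (k + 1)\<close>, \<open>k (k + 1)\<close> and \<open>(k - 1) (k + 2)\<close>, according to whether the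
  row and the column belong to the nonzero block of \<open>V_neg1 m\<close>. The smallest of these is
  \<open>(k - 2) (k + 1) = k (k - 1) - 2\<close>, and the matrix units are orthonormal for the Frobenius inner
  product, so the inverse of \<open>T_op m k\<close> has Frobenius operator norm at most
  \<open>1 / (k (k - 1) - 2)\<close> (\<open>norm_inv_T_op_le\<close>).

  The Frobenius norm is submultiplicative (\<open>norm_matrix_matrix_mult_le\<close>). If \<open>V i\<close> has norm at
  most \<open>1 / 2 ^ (i + 2)\<close> for all \<open>i < k\<close>, then every product \<open>V j ** V (k - 1 - j)\<close> therefore has
  norm at most \<open>1 / 2 ^ (k + 3)\<close>, independently of \<open>j\<close>. The weights \<open>j\<close> of the recursion add up
  to \<open>k (k - 1) / 2\<close>, so the norm of \<open>V k\<close> is at most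
  \<open>1 / 2 ^ (k + 2)\<close> times \<open>k (k - 1) / (4 (k (k - 1) - 2))\<close>. The last factor is at most \<open>1\<close> as soon
  as \<open>k (k - 1) \<ge> 8 / 3\<close>, which holds for \<open>k \<ge> 3\<close>.
\<close>

text \<open>
  By Cauchy--Schwarz each entry of the product is at most the norm of a row of \<open>A\<close> times the norm
  of a column of \<open>B\<close>; the squares of these bounds sum to the product of the squared norms.
\<close>

lemma norm_matrix_matrix_mult_le:
  fixes A :: "('a::real_normed_algebra_1) ^ 'n ^ 'm" and B :: "'a ^ 'p ^ 'n"
  shows "norm (A ** B) \<le> norm A * norm B"
proof -
  have norm_sq: "(norm M)\<^sup>2 = (\<Sum>i\<in>UNIV. \<Sum>j\<in>UNIV. (norm (M $ i $ j))\<^sup>2)"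
    for M :: "'a ^ 'x ^ 'y"
    by (simp add: norm_vec_def L2_set_def sum_nonneg)
  have entry: "(norm ((A ** B) $ i $ j))\<^sup>2
      \<le> (\<Sum>l\<in>UNIV. (norm (A $ i $ l))\<^sup>2) * (\<Sum>l\<in>UNIV. (norm (B $ l $ j))\<^sup>2)" for i j
  proof -
    have "norm ((A ** B) $ i $ j) \<le> (\<Sum>l\<in>UNIV. norm (A $ i $ l) * norm (B $ l $ j))"
      unfolding matrix_matrix_mult_def
      by (simp add: sum_norm_le norm_mult_ineq)
    then have "(norm ((A ** B) $ i $ j))\<^sup>2
        \<le> (\<Sum>l\<in>UNIV. norm (A $ i $ l) * norm (B $ l $ j))\<^sup>2"
      by (simp add: power_mono)
    also have "\<dots> \<le> (\<Sum>l\<in>UNIV. (norm (A $ i $ l))\<^sup>2) * (\<Sum>l\<in>UNIV. (norm (B $ l $ j))\<^sup>2)"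
      by (rule Cauchy_Schwarz_ineq_sum)
    finally show ?thesis .
  qed
  have "(norm (A ** B))\<^sup>2 \<le> (\<Sum>i\<in>UNIV. \<Sum>j\<in>UNIV.
      (\<Sum>l\<in>UNIV. (norm (A $ i $ l))\<^sup>2) * (\<Sum>l\<in>UNIV. (norm (B $ l $ j))\<^sup>2))"
    unfolding norm_sq by (intro sum_mono entry)
  also have "\<dots> = (norm A)\<^sup>2 * (\<Sum>j\<in>UNIV. \<Sum>l\<in>UNIV. (norm (B $ l $ j))\<^sup>2)"
    by (simp add: norm_sq sum_product)
  also have "\<dots> = (norm A * norm B)\<^sup>2"
    by (subst sum.swap) (simp add: norm_sq power_mult_distrib)
  finally show ?thesis
    by (rule power2_le_imp_le) simp
qed

text \<open>
  The constant is the eigenvalue of \<open>T_op m k\<close> on the matrix units whose row lies in the nonzero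
  block of \<open>V_neg1 m\<close> and whose column does not; the three other positions give larger ones. In
  the proof, \<open>w\<close> is the diagonal of \<open>V_neg1 m\<close> and \<open>e\<close> the eigenvalue at position \<open>(i, j)\<close>.
\<close>

lemma norm_T_op_ge:
  fixes a :: "('n::{finite,linorder}) sqmat"
  assumes "k \<ge> 2"
  shows "(real k * (real k - 1) - 2) * norm a \<le> norm (T_op m k a)"
proof -
  define c where "c = real k * (real k - 1) - 2"
  define w where "w = (\<lambda>i::'n. if card {l. l < i} < m then -2 else 0 :: real)"
  have "real k * (real k - 1) \<ge> 2 * 1"
    using assms by (intro mult_mono) auto
  then have c0: "c \<ge> 0"
    by (simp add: c_def)
  have entry: "norm ((c *\<^sub>R a) $ i $ j) \<le> norm (T_op m k a $ i $ j)" for i j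
  proof -
    define e where "e = real k * (real k - 1) + w i - real k * w j"
    have e: "c \<le> e"
      by (simp add: c_def e_def w_def)
    have "T_op m k a $ i $ j = of_real e * a $ i $ j"
      by (simp add: T_op_nth e_def w_def)
    then show ?thesis
      using e c0 by (simp add: norm_mult mult_right_mono)
  qed
  have "norm (c *\<^sub>R a) \<le> norm (T_op m k a)"
    by (intro norm_le_componentwise_cart entry)
  then show ?thesis
    using c0 by (simp add: c_def)
qed

lemma norm_inv_T_op_le:
  fixes b :: "('n::{finite,linorder}) sqmat"
  assumes "k \<ge> 3"
  shows "norm (inv (T_op m k) b) \<le> norm b / (real k * (real k - 1) - 2)"
proof -
  have "real k * (real k - 1) \<ge> 3 * 2"
    using assms by (intro mult_mono) auto
  moreover have "T_op m k (inv (T_op m k) b) = b"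
    by (rule surj_f_inv_f[OF bij_is_surj[OF bij_T_op[OF assms]]])
  then have "(real k * (real k - 1) - 2) * norm (inv (T_op m k) b) \<le> norm b"
    using norm_T_op_ge[of k "inv (T_op m k) b" m] assms by simp
  ultimately show ?thesis
    by (simp add: pos_le_divide_eq mult.commute)
qed

theorem theorem1:
  fixes V :: "nat \<Rightarrow> ('n::{finite,linorder}) sqmat"
    and m :: nat
  assumes "m \<le> CARD('n)"
    and "V_neg1 m ** V 0 = 0"
    and "V_neg1 m ** V 1 = 0"
    and "T_op m 2 (V 2) = V 1 ** V 0"
    and "\<And>k. k \<ge> 3 \<Longrightarrow>
           V k = (\<Sum>j=1..k-1. real j *\<^sub>R inv (T_op m k) (V j ** V (k - 1 - j)))"
    and "frobenius_norm (V 0) \<le> 1 / 4"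
    and "frobenius_norm (V 1) \<le> 1 / 8"
    and "frobenius_norm (V 2) \<le> 1 / 16"
  shows "\<forall>k\<ge>3. frobenius_norm (V k) \<le> 1 / 2 ^ (k + 2)"
proof -
  have bound: "norm (V k) \<le> 1 / 2 ^ (k + 2)" for k
  proof (induction k rule: less_induct)
    case (less k)
    show ?case
    proof (cases "k \<ge> 3")
      case False
      then consider "k = 0" | "k = 1" | "k = 2"
        by linarith
      then show ?thesis
        using assms(6-8) by cases (simp_all add: frobenius_norm_eq_norm)
    next
      case True
      define q where "q = real k * (real k - 1)"
      have "q \<ge> 3 * 2"
        unfolding q_def using True by (intro mult_mono) auto
      then have q: "q \<ge> 6"
        by simp
      define B where "B = 1 / 2 ^ (k + 3) / (q - 2)"
      have summand: "norm (real j *\<^sub>R inv (T_op m k) (V j ** V (k - 1 - j))) \<le> real j * B"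
        if j: "j \<in> {1..k-1}" for j
      proof -
        have "norm (V j ** V (k - 1 - j)) \<le> norm (V j) * norm (V (k - 1 - j))"
          by (rule norm_matrix_matrix_mult_le)
        also have "\<dots> \<le> 1 / 2 ^ (j + 2) * (1 / 2 ^ (k - 1 - j + 2))"
          using j by (intro mult_mono less.IH) auto
        also have "\<dots> = 1 / 2 ^ (j + 2 + (k - 1 - j + 2))"
          by (simp only: power_add) simp
        also have "j + 2 + (k - 1 - j + 2) = k + 3"
          using j by auto
        finally have prod: "norm (V j ** V (k - 1 - j)) \<le> 1 / 2 ^ (k + 3)" .
        have "norm (inv (T_op m k) (V j ** V (k - 1 - j))) \<le> norm (V j ** V (k - 1 - j)) / (q - 2)"
          unfolding q_def by (rule norm_inv_T_op_le[OF True])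
        also have "\<dots> \<le> B"
          unfolding B_def using prod q by (intro divide_right_mono) auto
        finally show ?thesis
          by (simp add: mult_left_mono)
      qed
      have "norm (V k) \<le> (\<Sum>j=1..k-1. real j * B)"
        unfolding assms(5)[OF True] by (intro sum_norm_le summand)
      also have "\<dots> = (\<Sum>j=1..k-1. real j) * B"
        by (simp add: sum_distrib_right)
      also have "(\<Sum>j=1..k-1. real j) = q / 2"
        using double_gauss_sum_from_Suc_0[of "k - 1", where 'a = real] True
        by (simp add: q_def of_nat_diff algebra_simps)
      also have "q / 2 * B = (q / (4 * (q - 2))) * (1 / 2 ^ (k + 2))"
        by (simp add: B_def power_add)
      also have "\<dots> \<le> 1 * (1 / 2 ^ (k + 2))"
        using q by (intro mult_right_mono) (simp_all add: divide_le_eq)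
      finally show ?thesis
        by simp
    qed
  qed
  show ?thesis
    by (simp only: frobenius_norm_eq_norm bound simp_thms)
qed

end
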